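(* Let $\varphi$ be a non-erasing morphism on a finite alphabet $\mathcal A$ such that: $\varphi(x)\ne\varphi(y)$ for all distinct letters $x,y$; $\varphi(x)$ is a primitive word for every letter $x$; and for any three distinct letters $a,b,c$ and integers $\alpha,\beta,\gamma$, if $\varphi(a)^\alpha\varphi(b)^\beta\varphi(c)^\gamma=\varepsilon$ (in the free group) then $\alpha\beta\gamma=0$. If $\varphi$ preserves richness, then $\varphi$ is of class $P$.
   Context: A finite word $w$ is rich if it has exactly $|w|+1$ distinct palindromic factors (including the empty word); an infinite word is rich if all its factors are rich. $\varphi$ preserves richness if $\varphi(w)$ is rich whenever $w\in\mathcal A^*\cup\mathcal A^\omega$ is rich. A word is primitive if it is not a power of a shorter word. A morphism $\varphi$ on $\mathcal A$ is a standard $P$-morphism if there is a palindrome $p$ (possibly empty) such that for every $x\in\mathcal A$, $\varphi(x)=pq_x$ where each $q_x$ is a palindrome (possibly empty), or, when $p$ is non-empty, $q_x=\pi_x^{-1}$ with $\pi_x$ a proper palindromic suffix of $p$ (meaning $\varphi(x)$ is $p$ with the suffix $\pi_x$ removed). A morphism $\psi$ is of class $P$ if there is a standard $P$-morphism $\varphi(x)=pq_x$ and a factorization $p=p'p''$ with $\psi(x)=p''q_xp'$ for all $x\in\mathcal A$. *)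

theory Defs
  imports "HOL-Library.Sublist" "HOL-Library.Stream" "HOL-Algebra.Group"
begin

subsection \<open>Rich words and morphisms\<close>

definition palindrome :: "'a list \<Rightarrow> bool" where
  "palindrome w \<longleftrightarrow> rev w = w"

definition rich :: "'a list \<Rightarrow> bool" where
  "rich w \<longleftrightarrow> card {v. sublist v w \<and> palindrome v} = length w + 1"

definition rich_inf :: "'a stream \<Rightarrow> bool" where
  "rich_inf s \<longleftrightarrow> (\<forall>m n. rich (stake n (sdrop m s)))"

definition primitive :: "'a list \<Rightarrow> bool" where
  "primitive w \<longleftrightarrow> \<not> (\<exists>u k. length u < length w \<and> w = concat (replicate k u))"

definition word_morphism :: "('a list \<Rightarrow> 'b list) \<Rightarrow> bool" where
  "word_morphism \<phi> \<longleftrightarrow> \<phi> [] = [] \<and> (\<forall>u v. \<phi> (u @ v) = \<phi> u @ \<phi> v)"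

definition non_erasing :: "('a list \<Rightarrow> 'b list) \<Rightarrow> bool" where
  "non_erasing \<phi> \<longleftrightarrow> (\<forall>x. \<phi> [x] \<noteq> [])"

text \<open>The extension of a morphism to infinite words. It is the infinite concatenation
  of the letter images only for a non-erasing morphism, since \<^const>\<open>flat\<close> is meaningful
  only on streams of non-empty lists.\<close>

definition morphism_inf :: "('a list \<Rightarrow> 'b list) \<Rightarrow> 'a stream \<Rightarrow> 'b stream" where
  "morphism_inf \<phi> s = flat (smap (\<lambda>x. \<phi> [x]) s)"

definition preserves_richness :: "('a list \<Rightarrow> 'b list) \<Rightarrow> bool" where
  "preserves_richness \<phi> \<longleftrightarrow>
     (\<forall>w. rich w \<longrightarrow> rich (\<phi> w)) \<and> (\<forall>s. rich_inf s \<longrightarrow> rich_inf (morphism_inf \<phi> s))"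

subsection \<open>The free group\<close>

text \<open>A signed letter \<open>(x, True)\<close> stands for \<open>x\<close> and \<open>(x, False)\<close> for its formal inverse.\<close>

inductive cancel_step :: "('a \<times> bool) list \<Rightarrow> ('a \<times> bool) list \<Rightarrow> bool" where
  "cancel_step (u @ [(x, s), (x, \<not> s)] @ v) (u @ v)"

quotient_type 'a free_grp = "('a \<times> bool) list" / "equivclp cancel_step"
  by (rule equivpI) (auto intro: reflpI sympI transpI equivclp_sym equivclp_trans)

lemma equivclp_map:
  assumes "equivclp r u v" and "\<And>u v. r u v \<Longrightarrow> r (f u) (f v)"
  shows "equivclp r (f u) (f v)"
  using assms(1)
proof (induction rule: equivclp_induct)
  case base
  show ?case by simp
next
  case (step y z)
  then have "equivclp r (f y) (f z)"
    using assms(2) by (metis r_into_equivclp equivclp_sym)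
  with step.IH show ?case by (rule equivclp_trans)
qed

lemma cancel_step_append_left: "cancel_step u v \<Longrightarrow> cancel_step (w @ u) (w @ v)"
  by (elim cancel_step.cases) (metis append.assoc cancel_step.intros)

lemma cancel_step_append_right: "cancel_step u v \<Longrightarrow> cancel_step (u @ w) (v @ w)"
  by (elim cancel_step.cases) (metis append.assoc cancel_step.intros)

definition formal_inverse :: "('a \<times> bool) list \<Rightarrow> ('a \<times> bool) list" where
  "formal_inverse w = rev (map (\<lambda>(x, s). (x, \<not> s)) w)"

lemma cancel_step_formal_inverse:
  "cancel_step u v \<Longrightarrow> cancel_step (formal_inverse u) (formal_inverse v)"
proof (elim cancel_step.cases)
  fix a x s b assume "u = a @ [(x, s), (x, \<not> s)] @ b" "v = a @ b"
  then show ?thesis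
    using cancel_step.intros[of "formal_inverse b" x s "formal_inverse a"]
    by (simp add: formal_inverse_def)
qed

lift_definition free_mult :: "'a free_grp \<Rightarrow> 'a free_grp \<Rightarrow> 'a free_grp" is "(@)"
proof -
  fix u u' v v' :: "('a \<times> bool) list"
  assume "equivclp cancel_step u u'" "equivclp cancel_step v v'"
  then have "equivclp cancel_step (u @ v) (u' @ v)" "equivclp cancel_step (u' @ v) (u' @ v')"
    using equivclp_map[where f = "\<lambda>w. w @ v"] equivclp_map[where f = "\<lambda>w. u' @ w"]
    by (blast intro: cancel_step_append_left cancel_step_append_right)+
  then show "equivclp cancel_step (u @ v) (u' @ v')" by (rule equivclp_trans)
qed

lift_definition free_one :: "'a free_grp" is "[]" .

lift_definition free_inverse :: "'a free_grp \<Rightarrow> 'a free_grp" is formal_inverse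
  by (erule equivclp_map) (rule cancel_step_formal_inverse)

definition free_group :: "'a free_grp monoid" where
  "free_group = \<lparr>carrier = UNIV, mult = free_mult, one = free_one\<rparr>"

lemma formal_inverse_cancel: "equivclp cancel_step (formal_inverse w @ w) []"
proof (induction w)
  case Nil
  show ?case by (simp add: formal_inverse_def)
next
  case (Cons a w)
  obtain x s where a: "a = (x, s)" by (cases a)
  have "cancel_step (formal_inverse (a # w) @ a # w) (formal_inverse w @ w)"
    using cancel_step.intros[of "formal_inverse w" x "\<not> s" w] a
    by (simp add: formal_inverse_def)
  then show ?case using Cons.IH by (metis r_into_equivclp equivclp_trans)
qed

lemma free_inverse_left: "free_mult (free_inverse g) g = free_one"
  by transfer (rule formal_inverse_cancel)

lemma group_free_group: "group free_group"
proof (rule groupI)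
  fix x y z :: "'a free_grp"
  show "x \<otimes>\<^bsub>free_group\<^esub> y \<otimes>\<^bsub>free_group\<^esub> z = x \<otimes>\<^bsub>free_group\<^esub> (y \<otimes>\<^bsub>free_group\<^esub> z)"
    unfolding free_group_def by simp (transfer, simp)
  show "\<one>\<^bsub>free_group\<^esub> \<otimes>\<^bsub>free_group\<^esub> x = x"
    unfolding free_group_def by simp (transfer, simp)
  show "\<exists>y\<in>carrier free_group. y \<otimes>\<^bsub>free_group\<^esub> x = \<one>\<^bsub>free_group\<^esub>"
    unfolding free_group_def using free_inverse_left by auto
qed (simp_all add: free_group_def)

lift_definition of_word :: "'a list \<Rightarrow> 'a free_grp" is "map (\<lambda>x. (x, True))" .

subsection \<open>Morphisms of class P\<close>

text \<open>The admissible \<open>q\<^sub>x\<close> for a palindrome \<open>p\<close> are elements of the free group: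
  palindromes, or inverses of proper palindromic suffixes of \<open>p\<close>.\<close>

definition P_tail :: "'a list \<Rightarrow> 'a free_grp \<Rightarrow> bool" where
  "P_tail p g \<longleftrightarrow>
     (\<exists>r. palindrome r \<and> g = of_word r) \<or>
     (p \<noteq> [] \<and> (\<exists>\<pi>. palindrome \<pi> \<and> strict_suffix \<pi> p \<and> g = inv\<^bsub>free_group\<^esub> (of_word \<pi>)))"

definition standard_P_with ::
  "'b list \<Rightarrow> ('a \<Rightarrow> 'b free_grp) \<Rightarrow> ('a list \<Rightarrow> 'b list) \<Rightarrow> bool" where
  "standard_P_with p q \<phi> \<longleftrightarrow>
     word_morphism \<phi> \<and> palindrome p \<and>
     (\<forall>x. P_tail p (q x) \<and> of_word (\<phi> [x]) = of_word p \<otimes>\<^bsub>free_group\<^esub> q x)"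

definition standard_P_morphism :: "('a list \<Rightarrow> 'b list) \<Rightarrow> bool" where
  "standard_P_morphism \<phi> \<longleftrightarrow> (\<exists>p q. standard_P_with p q \<phi>)"

definition class_P :: "('a list \<Rightarrow> 'b list) \<Rightarrow> bool" where
  "class_P \<psi> \<longleftrightarrow>
     word_morphism \<psi> \<and>
     (\<exists>\<phi> p q p' p''. standard_P_with p q \<phi> \<and> p = p' @ p'' \<and>
        (\<forall>x. of_word (\<psi> [x]) = of_word p'' \<otimes>\<^bsub>free_group\<^esub> q x \<otimes>\<^bsub>free_group\<^esub> of_word p'))"

end

theory Submission
  imports Defs
begin

text \<open>
  A rich word has a palindromic suffix occurring in it only once. This is applied to the images of
  the rich words $a^n b^m a^i$ and $a^n b^m c^k b^m a^i$ with $n$ and $i$ large. Write $U, V, X$ for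
  the images of $a, b, c$, and let $s$ and $t$ be the lengths of the longest common suffix of the
  left-infinite words ${}^\omega U, {}^\omega V$ and of the longest common prefix of
  $U^\omega, V^\omega$; they are finite because $U$ and $V$ are primitive and distinct. The runs
  of $U$ at both ends of the image extend by exactly $s$ or $t$ letters into the middle part, and a
  palindromic suffix that does not recur must interchange these two maximal runs, which fixes its
  centre. Hence the bi-infinite word ${}^\omega U^\omega$ has a symmetry axis determined by $t - s$
  alone, and in the three-letter case, where the axis also has to be that of the central run of $X$,
  the number $t - s$ is the same for the pairs $a, b$ and $b, c$. So $t - s$ is constant; for a pair
  of letters minimising $s$, the $s$ letters to the left and the $t$ letters to the right of the
  origin are common to all ${}^\omega \varphi(x)^\omega$, and they form the palindrome $p = p'p''$
  of a class $P$ presentation.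
\<close>

section \<open>Rich words\<close>

definition pal_factors :: "'a list \<Rightarrow> 'a list set" where
  "pal_factors w = {v. sublist v w \<and> palindrome v}"

lemma finite_pal_factors: "finite (pal_factors w)"
proof -
  have "pal_factors w \<subseteq> set (sublists w)"
    by (auto simp: pal_factors_def)
  then show ?thesis
    using finite_subset by blast
qed

lemma rich_iff_card_pal_factors: "rich w \<longleftrightarrow> card (pal_factors w) = length w + 1"
  by (simp add: rich_def pal_factors_def)

text \<open>A palindromic suffix that is not the longest one recurs as a prefix of the longest one.\<close>

lemma new_pal_factor_unique:
  assumes "v \<in> pal_factors (w @ [x]) - pal_factors w"
    and "v' \<in> pal_factors (w @ [x]) - pal_factors w"
  shows "v = v'"
proof -
  have suffix: "suffix u (w @ [x])" if "u \<in> pal_factors (w @ [x]) - pal_factors w" for u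
    using that by (auto simp: pal_factors_def sublist_snoc)
  have eq: "u = u'"
    if "u \<in> pal_factors (w @ [x]) - pal_factors w"
      and u': "u' \<in> pal_factors (w @ [x]) - pal_factors w"
      and "length u \<le> length u'" for u u'
  proof (rule ccontr)
    assume "u \<noteq> u'"
    have pal: "rev u = u" "rev u' = u'"
      using that by (auto simp: pal_factors_def palindrome_def)
    have "suffix u u'"
      using suffix that by (meson suffix_length_suffix)
    then have "prefix u u'"
      using pal by (metis suffix_to_prefix)
    with \<open>u \<noteq> u'\<close> obtain z where z: "u' = u @ z" "z \<noteq> []"
      by (auto simp: prefix_def)
    obtain r where "w @ [x] = r @ u'"
      using suffix[OF u'] by (auto simp: suffix_def)
    \<comment> \<open>The dropped last letter belongs to the non-empty \<open>z\<close>, so this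
      prefix copy of \<open>u\<close> survives in \<open>w\<close>.\<close>
    with z have "w = r @ u @ butlast z"
      by (metis append.assoc append_is_Nil_conv butlast_append butlast_snoc)
    then have "sublist u w"
      by simp
    then show False
      using that by (auto simp: pal_factors_def)
  qed
  then show ?thesis
    using assms by (metis nle_le)
qed

lemma pal_factors_mono: "pal_factors w \<subseteq> pal_factors (w @ u)"
  by (auto simp: pal_factors_def) (meson sublist_append_rightI sublist_order.order_trans)

lemma card_pal_factors_snoc_le: "card (pal_factors (w @ [x])) \<le> Suc (card (pal_factors w))"
proof -
  have "card (pal_factors (w @ [x]) - pal_factors w) \<le> 1"
    using new_pal_factor_unique finite_pal_factors
    by (metis (no_types, lifting) One_nat_def card_le_Suc0_iff_eq finite_Diff)
  then show ?thesis
    using card_Diff_subset[OF finite_pal_factors pal_factors_mono, of w "[x]"]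
    by simp
qed

lemma card_pal_factors_le: "card (pal_factors w) \<le> length w + 1"
proof (induction w rule: rev_induct)
  case Nil
  have "pal_factors [] \<subseteq> {[] :: 'a list}"
    by (auto simp: pal_factors_def)
  then show ?case
    using card_mono[of "{[] :: 'a list}"] by fastforce
next
  case (snoc x w)
  then show ?case
    using card_pal_factors_snoc_le[of w x] by simp
qed

lemma rich_Nil: "rich []"
proof -
  have "pal_factors [] = {[] :: 'a list}"
    by (auto simp: pal_factors_def palindrome_def)
  then show ?thesis
    by (simp add: rich_iff_card_pal_factors)
qed

text \<open>A rich word attains the bound \<open>card_pal_factors_le\<close>; the new suffix raises
  the count by one, and the bound for the longer word allows no more.\<close>

lemma rich_snocI:
  assumes "rich w" "palindrome v" "suffix v (w @ [x])" "\<not> sublist v w"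
  shows "rich (w @ [x])"
proof -
  have "v \<in> pal_factors (w @ [x]) - pal_factors w"
    using assms suffix_imp_sublist by (auto simp: pal_factors_def)
  then have "pal_factors w \<subset> pal_factors (w @ [x])"
    using pal_factors_mono by blast
  then have "card (pal_factors w) < card (pal_factors (w @ [x]))"
    by (rule psubset_card_mono[OF finite_pal_factors])
  then show ?thesis
    using assms(1) card_pal_factors_le[of "w @ [x]"] by (simp add: rich_iff_card_pal_factors)
qed

text \<open>Since \<open>w\<close> has at most \<open>length w + 1\<close> palindromic factors, the
  last letter must create one, and a factor that is new has to be a suffix.\<close>

lemma rich_obtain_new_suffix:
  assumes "rich (w @ [x])"
  obtains v where "palindrome v" "suffix v (w @ [x])" "\<not> sublist v w"
proof -
  have "card (pal_factors w) < card (pal_factors (w @ [x]))"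
    using assms card_pal_factors_le[of w] by (simp add: rich_iff_card_pal_factors)
  then have "\<not> pal_factors (w @ [x]) \<subseteq> pal_factors w"
    using card_mono[OF finite_pal_factors] by (metis leD)
  then obtain v where "v \<in> pal_factors (w @ [x])" "v \<notin> pal_factors w"
    by blast
  then show thesis
    using that by (auto simp: pal_factors_def sublist_snoc)
qed

section \<open>Rich words built from runs of letters\<close>

lemma palindrome_replicate: "palindrome (replicate n a)"
  by (simp add: palindrome_def)

lemma palindrome_enclose:
  "palindrome z \<Longrightarrow> palindrome (y @ z @ rev y)"
  by (simp add: palindrome_def)

lemma count_list_replicate: "count_list (replicate n a) x = (if a = x then n else 0)"
  by (induction n) auto

lemma sublist_count_le: "sublist v w \<Longrightarrow> count_list v x \<le> count_list w x"
  by (auto simp: sublist_def)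

text \<open>Each further \<open>b\<close> completes a run of \<open>b\<close> longer than any
  before, and this run is the new palindromic suffix.\<close>

lemma rich_append_replicate_fresh:
  assumes "rich w" "b \<notin> set w"
  shows "rich (w @ replicate m b)"
proof (induction m)
  case 0
  then show ?case using assms by simp
next
  case (Suc m)
  have "\<not> sublist (replicate (Suc m) b) (w @ replicate m b)"
    using sublist_count_le[of "replicate (Suc m) b" "w @ replicate m b" b] assms(2)
    by (auto simp del: replicate_Suc simp: count_list_replicate)
  moreover have "suffix (replicate (Suc m) b) ((w @ replicate m b) @ [b])"
    by (simp add: replicate_append_same[symmetric] suffix_def)
  ultimately show ?case
    using rich_snocI[OF Suc palindrome_replicate, of "Suc m" b b]
    by (simp add: replicate_append_same)
qed

text \<open>An occurrence of \<^term>\<open>d\<close> in the middle block forces the two copies of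
  the middle block to coincide, and then the right-hand run is too short.\<close>

lemma not_sublist_enclosed:
  assumes "d \<in> set z" "d \<notin> set x" "d \<noteq> e"
  shows "\<not> sublist (replicate (Suc i) e @ z @ replicate (Suc i) e) (x @ z @ replicate i e)"
proof
  assume "sublist (replicate (Suc i) e @ z @ replicate (Suc i) e) (x @ z @ replicate i e)"
  then obtain l r where eq:
    "x @ z @ replicate i e = l @ (replicate (Suc i) e @ z @ replicate (Suc i) e) @ r"
    by (auto simp: sublist_def)
  \<comment> \<open>On the left every \<open>d\<close> lies in \<open>z\<close>, and the right-hand
    side already contains a copy of \<open>z\<close>; hence no \<open>d\<close> is left for
    \<open>r\<close>.\<close>
  have "count_list (x @ z @ replicate i e) d = count_list z d"
    using assms by (simp add: count_list_replicate count_list_0_iff)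
  with eq have "count_list r d = 0"
    using assms by (simp add: count_list_replicate)
  then have r: "d \<notin> set r"
    by (simp add: count_list_0_iff)
  \<comment> \<open>Both sides are read backwards up to the first \<open>d\<close>. This yields what
    follows \<open>z\<close> and then the same piece of \<open>rev z\<close>, so that the lengths of
    the parts after \<open>z\<close> can be compared.\<close>
  have tw: "takeWhile (\<lambda>y. y \<noteq> d) (ys @ rev z @ zs) = ys @ takeWhile (\<lambda>y. y \<noteq> d) (rev z)"
    if "d \<notin> set ys" for ys zs
  proof -
    have "takeWhile (\<lambda>y. y \<noteq> d) (rev z @ zs) = takeWhile (\<lambda>y. y \<noteq> d) (rev z)"
      using assms(1) by simp
    then show ?thesis
      using that by (subst takeWhile_append2) auto
  qed
  have "rev (x @ z @ replicate i e) = replicate i e @ rev z @ rev x"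
    by simp
  moreover have "rev (l @ (replicate (Suc i) e @ z @ replicate (Suc i) e) @ r)
    = (rev r @ replicate (Suc i) e) @ rev z @ (replicate (Suc i) e @ rev l)"
    by (simp del: replicate_Suc)
  ultimately have "replicate i e @ takeWhile (\<lambda>y. y \<noteq> d) (rev z)
    = (rev r @ replicate (Suc i) e) @ takeWhile (\<lambda>y. y \<noteq> d) (rev z)"
    using tw[of "replicate i e" "rev x"] tw[of "rev r @ replicate (Suc i) e" "replicate (Suc i) e @ rev l"]
      eq r assms(3) by (auto simp del: replicate_Suc)
  then have "length (replicate i e) = length (rev r @ replicate (Suc i) e)"
    by (metis append_same_eq)
  then show False
    by simp
qed

text \<open>The \<open>i\<close>-th appended \<open>e\<close> completes the palindrome
  \<open>replicate i e @ z @ replicate i e\<close>, whose left run is available because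
  \<open>i \<le> n\<close>; the letter \<open>d\<close> in \<open>z\<close> keeps it from occurring
  earlier.\<close>

lemma rich_append_replicate_enclosed:
  assumes "rich (x @ replicate n e @ z)" "palindrome z"
    and "d \<in> set z" "d \<notin> set x" "d \<noteq> e" "i \<le> n"
  shows "rich (x @ replicate n e @ z @ replicate i e)"
  using \<open>i \<le> n\<close>
proof (induction i)
  case 0
  then show ?case using assms by simp
next
  case (Suc i)
  let ?v = "replicate (Suc i) e @ z @ replicate (Suc i) e"
  have n: "replicate n e = replicate (n - Suc i) e @ replicate (Suc i) e"
    using Suc.prems by (simp add: replicate_add[symmetric] del: replicate_Suc)
  have "\<not> sublist ?v (x @ replicate n e @ z @ replicate i e)"
    using not_sublist_enclosed[of d z "x @ replicate n e" e i] assms by auto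
  moreover have "palindrome ?v"
    using palindrome_enclose[OF assms(2), of "replicate (Suc i) e"] by (simp del: replicate_Suc)
  moreover have "(x @ replicate n e @ z @ replicate i e) @ [e] = x @ replicate n e @ z @ replicate (Suc i) e"
    by (simp add: replicate_append_same)
  moreover have "suffix ?v (x @ replicate n e @ z @ replicate (Suc i) e)"
    unfolding n by (metis append.assoc suffixI)
  ultimately show ?case
    using rich_snocI[of "x @ replicate n e @ z @ replicate i e" ?v e] Suc by (simp del: replicate_Suc)
qed

lemma rich_two_letters:
  assumes "a \<noteq> b" "m > 0" "i \<le> n"
  shows "rich (replicate n a @ replicate m b @ replicate i a)"
proof -
  have "rich (replicate n a)"
    using rich_append_replicate_fresh[OF rich_Nil, of a n] by simp
  then have "rich (replicate n a @ replicate m b)"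
    using rich_append_replicate_fresh assms(1) by force
  then show ?thesis
    using rich_append_replicate_enclosed[of "[]" n a "replicate m b" b i] assms
    by (simp add: palindrome_replicate)
qed

lemma rich_three_letters:
  assumes "a \<noteq> b" "b \<noteq> c" "a \<noteq> c" "m > 0" "k > 0" "i \<le> n"
  shows "rich (replicate n a @ (replicate m b @ replicate k c @ replicate m b) @ replicate i a)"
proof -
  have "rich (replicate n a @ replicate m b)"
    using rich_two_letters[OF assms(1,4), of 0 n] by simp
  then have "rich ((replicate n a @ replicate m b) @ replicate k c)"
    by (rule rich_append_replicate_fresh) (use assms in auto)
  then have "rich (replicate n a @ replicate m b @ replicate k c @ replicate m b)"
    using rich_append_replicate_enclosed[of "replicate n a" m b "replicate k c" c m] assms
    by (simp add: palindrome_replicate)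
  moreover have "palindrome (replicate m b @ replicate k c @ replicate m b)"
    by (simp add: palindrome_def)
  \<comment> \<open>The enclosed block is now the whole palindrome around the run of
    \<open>c\<close>, with \<open>b\<close> in the role of \<open>d\<close>.\<close>
  ultimately show ?thesis
    using rich_append_replicate_enclosed[of "[]" n a "replicate m b @ replicate k c @ replicate m b" b i]
      assms by auto
qed

section \<open>Periodic bi-infinite words\<close>

abbreviation word_pow :: "'a list \<Rightarrow> nat \<Rightarrow> 'a list" where
  "word_pow w n \<equiv> concat (replicate n w)"

lemma length_word_pow: "length (word_pow w n) = n * length w"
  by (induction n) auto

text \<open>The bi-infinite repetition of \<open>w\<close>, with a copy of \<open>w\<close> starting
  at the origin. For non-empty \<open>w\<close> the integer \<open>mod\<close> is non-negative, so
  negative positions are covered as well.\<close>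

definition periodic_ext :: "'a list \<Rightarrow> int \<Rightarrow> 'a" where
  "periodic_ext w j = w ! nat (j mod int (length w))"

lemma periodic_ext_add_mult [simp]:
  "periodic_ext w (j + k * int (length w)) = periodic_ext w j"
  "periodic_ext w (j + int (length w) * k) = periodic_ext w j"
  by (simp_all add: periodic_ext_def)

lemma periodic_ext_add [simp]: "periodic_ext w (j + int (length w)) = periodic_ext w j"
  by (simp add: periodic_ext_def)

lemma periodic_ext_diff [simp]: "periodic_ext w (j - int (length w)) = periodic_ext w j"
  by (simp add: periodic_ext_def)

lemma periodic_ext_diff_mult [simp]:
  "periodic_ext w (j - k * int (length w)) = periodic_ext w j"
  using periodic_ext_add_mult(1)[of w "j - k * int (length w)" k] by simp

text \<open>List positions are treated as integers, so that shifts and reflections are free of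
  truncated subtraction.\<close>

lemma nth_append_int:
  "0 \<le> j \<Longrightarrow> (xs @ ys) ! nat j = (if j < int (length xs) then xs ! nat j else ys ! nat (j - int (length xs)))"
  by (auto simp: nth_append nat_diff_distrib)

lemma nth_periodic_ext: "0 \<le> j \<Longrightarrow> j < int (length w) \<Longrightarrow> w ! nat j = periodic_ext w j"
  by (simp add: periodic_ext_def)

lemma nth_word_pow:
  "0 \<le> j \<Longrightarrow> j < int (n * length w) \<Longrightarrow> word_pow w n ! nat j = periodic_ext w j"
proof (induction n arbitrary: j)
  case 0
  then show ?case by simp
next
  case (Suc n)
  show ?case
  proof (cases "j < int (length w)")
    case True
    then show ?thesis
      using Suc.prems nth_periodic_ext[of j w] by (simp add: nth_append_int)
  next
    case False
    then have "word_pow w n ! nat (j - int (length w)) = periodic_ext w (j - int (length w))"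
      using Suc.prems by (intro Suc.IH) auto
    then show ?thesis
      using False Suc.prems by (simp add: nth_append_int)
  qed
qed

text \<open>Commuting words are powers of a common word, and primitivity forces both exponents to be
  1.\<close>

lemma primitive_commute_eq:
  assumes "U @ V = V @ U" "primitive U" "primitive V" "U \<noteq> []" "V \<noteq> []"
  shows "U = V"
proof -
  obtain m n z where z: "word_pow z m = U" "word_pow z n = V"
    using comm_append_are_replicate[OF assms(1)] by blast
  have *: "w = z" if "word_pow z k = w" "primitive w" "w \<noteq> []" for k w
  proof -
    have "length w \<le> length z"
      using that unfolding primitive_def by (metis not_le)
    moreover have "length w = k * length z" "k \<noteq> 0"
      using that length_word_pow[of k z] by auto
    ultimately have "k = 1"
      using \<open>w \<noteq> []\<close> by (cases k) auto
    then show ?thesis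
      using that by simp
  qed
  show ?thesis
    using *[of m U] *[of n V] z assms by simp
qed

text \<open>\<open>U @ V\<close> and \<open>V @ U\<close> are both read off the common periodic word
  from the origin on, so \<open>U\<close> and \<open>V\<close> commute.\<close>

lemma periodic_ext_inj_primitive:
  assumes "primitive U" "primitive V" "U \<noteq> []" "V \<noteq> []"
    and eq: "\<And>j. periodic_ext U j = periodic_ext V j"
  shows "U = V"
proof -
  have *: "(xs @ ys) ! nat j = periodic_ext xs j"
    if "\<And>j. periodic_ext xs j = periodic_ext ys j" "0 \<le> j" "j < int (length (xs @ ys))"
    for xs ys :: "'a list" and j
  proof (cases "j < int (length xs)")
    case False
    then have "(xs @ ys) ! nat j = periodic_ext ys (j - int (length xs))"
      using that nth_periodic_ext[of "j - int (length xs)" ys] by (simp add: nth_append_int)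
    also have "\<dots> = periodic_ext xs j"
      using that(1)[of "j - int (length xs)"] by simp
    finally show ?thesis .
  qed (use that(2) nth_periodic_ext[of j xs] in \<open>simp add: nth_append_int\<close>)
  have "U @ V = V @ U"
  proof (rule nth_equalityI)
    fix k assume "k < length (U @ V)"
    then show "(U @ V) ! k = (V @ U) ! k"
      using *[of U V "int k"] *[of V U "int k"] eq by simp
  qed simp
  then show ?thesis
    using assms primitive_commute_eq by blast
qed

section \<open>Maximal agreement of two periodic words around the origin\<close>

text \<open>For periodic extensions, \<open>s\<close> is the length of the longest common suffix of
  the left halves and \<open>t\<close> that of the longest common prefix of the right
  halves.\<close>

definition max_agreement :: "(int \<Rightarrow> 'a) \<Rightarrow> (int \<Rightarrow> 'a) \<Rightarrow> int \<Rightarrow> int \<Rightarrow> bool" where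
  "max_agreement f g s t \<longleftrightarrow> 0 \<le> s \<and> 0 \<le> t \<and> (\<forall>j. - s \<le> j \<and> j < t \<longrightarrow> f j = g j) \<and>
     f t \<noteq> g t \<and> f (- s - 1) \<noteq> g (- s - 1)"

lemma max_agreement_sym: "max_agreement f g s t \<Longrightarrow> max_agreement g f s t"
  unfolding max_agreement_def by metis

lemma max_agreement_unique:
  assumes "max_agreement f g s t" "max_agreement f g s' t'"
  shows "s = s'" "t = t'"
proof -
  have 1: "0 \<le> s" "0 \<le> t" "\<And>j. - s \<le> j \<Longrightarrow> j < t \<Longrightarrow> f j = g j" "f t \<noteq> g t" "f (- s - 1) \<noteq> g (- s - 1)"
    using assms(1) by (auto simp: max_agreement_def)
  have 2: "0 \<le> s'" "0 \<le> t'" "\<And>j. - s' \<le> j \<Longrightarrow> j < t' \<Longrightarrow> f j = g j" "f t' \<noteq> g t'"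
    "f (- s' - 1) \<noteq> g (- s' - 1)"
    using assms(2) by (auto simp: max_agreement_def)
  have "\<not> t < t'" "\<not> t' < t"
    using 1(1,2,4) 2(3)[of t] 2(1,2,4) 1(3)[of t'] by auto
  then show "t = t'"
    by simp
  have "\<not> s < s'" "\<not> s' < s"
    using 1(1,2,5) 2(3)[of "- s - 1"] 2(1,2,5) 1(3)[of "- s' - 1"] by auto
  then show "s = s'"
    by simp
qed

text \<open>The two extensions differ somewhere, and the mismatch recurs with the common period
  \<open>l\<close>, hence on both sides of the origin.\<close>

lemma max_agreement_exists:
  assumes "primitive U" "primitive V" "U \<noteq> []" "V \<noteq> []" "U \<noteq> V"
  shows "\<exists>s t. max_agreement (periodic_ext U) (periodic_ext V) s t"
proof -
  let ?g = "periodic_ext U" and ?h = "periodic_ext V"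
  define l where "l = int (length U) * int (length V)"
  have l: "l \<ge> 1"
    using assms unfolding l_def by (metis int_one_le_iff_zero_less length_greater_0_conv mult_pos_pos of_nat_0_less_iff)
  obtain j where j: "?g j \<noteq> ?h j"
    using assms periodic_ext_inj_primitive by metis
  have shift: "?g (j + k * l) \<noteq> ?h (j + k * l)" for k
  proof -
    have "?g (j + k * l) = ?g j"
      using periodic_ext_add_mult(1)[of U j "k * int (length V)"] by (simp add: l_def ac_simps)
    moreover have "?h (j + k * l) = ?h j"
      using periodic_ext_add_mult(1)[of V j "k * int (length U)"] by (simp add: l_def ac_simps)
    ultimately show ?thesis
      using j by simp
  qed
  \<comment> \<open>Moving by \<open>\<bar>j\<bar>\<close> common periods to the right, or by one
    more to the left, carries \<open>j\<close> across the origin.\<close>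
  have bound: "\<bar>j\<bar> \<le> \<bar>j\<bar> * l"
    using l mult_left_mono[of 1 l "\<bar>j\<bar>"] by simp
  have "0 \<le> j + \<bar>j\<bar> * l"
    using bound by linarith
  then have ex_t: "\<exists>n::nat. ?g (int n) \<noteq> ?h (int n)"
    using shift[of "\<bar>j\<bar>"] by (intro exI[of _ "nat (j + \<bar>j\<bar> * l)"]) simp
  have "j + (- \<bar>j\<bar> - 1) * l \<le> - 1"
    using bound l by (simp add: algebra_simps)
  then have ex_s: "\<exists>n::nat. ?g (- int n - 1) \<noteq> ?h (- int n - 1)"
    using shift[of "- \<bar>j\<bar> - 1"] by (intro exI[of _ "nat (- (j + (- \<bar>j\<bar> - 1) * l) - 1)"]) simp
  define t where "t = (LEAST n::nat. ?g (int n) \<noteq> ?h (int n))"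
  \<comment> \<open>The first position left of the origin is \<open>-1\<close>, so after
    \<open>n\<close> agreeing letters the next one to compare is at \<open>- n - 1\<close>.\<close>
  define s where "s = (LEAST n::nat. ?g (- int n - 1) \<noteq> ?h (- int n - 1))"
  have "?g i = ?h i" if "- int s \<le> i" "i < int t" for i
  proof (cases "i \<ge> 0")
    case True
    then show ?thesis
      using not_less_Least[of "nat i" "\<lambda>n. ?g (int n) \<noteq> ?h (int n)"] that t_def by force
  next
    case False
    then have "nat (- i - 1) < s"
      using that by linarith
    then have "?g (- int (nat (- i - 1)) - 1) = ?h (- int (nat (- i - 1)) - 1)"
      unfolding s_def using not_less_Least by blast
    then show ?thesis
      using False by simp
  qed
  moreover have "?g (int t) \<noteq> ?h (int t)"
    unfolding t_def by (rule LeastI_ex[OF ex_t])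
  moreover have "?g (- int s - 1) \<noteq> ?h (- int s - 1)"
    unfolding s_def by (rule LeastI_ex[OF ex_s])
  ultimately have "max_agreement ?g ?h (int s) (int t)"
    by (simp add: max_agreement_def)
  then show ?thesis
    by blast
qed

section \<open>Symmetry axes of images of rich words\<close>

text \<open>The maximal run of period \<^term>\<open>u\<close> at the end of \<^term>\<open>f\<close> begins at \<^term>\<open>b - s\<close>, the one at
  the beginning ends at \<^term>\<open>n + t\<close>. Reflection in a palindromic suffix that is longer than
  the final run sends the former to a run ending with a defect of periodicity, which can only be
  the end of the latter.\<close>

lemma palindromic_suffix_start:
  fixes f :: "int \<Rightarrow> 'a" and u n b l s t x :: int
  assumes per_left: "\<And>j. 0 \<le> j \<Longrightarrow> j < n + t - u \<Longrightarrow> f j = f (j + u)"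
    and defect_left: "f (n + t - u) \<noteq> f (n + t)"
    and per_right: "\<And>j. b - s \<le> j \<Longrightarrow> j + u < b + l \<Longrightarrow> f j = f (j + u)"
    and defect_right: "f (b - s - 1) \<noteq> f (b - s - 1 + u)"
    and pal: "\<And>j. x \<le> j \<Longrightarrow> j < b + l \<Longrightarrow> f j = f (x + b + l - 1 - j)"
    and "0 \<le> x" "x < b - s" "0 \<le> s" "0 \<le> t" "0 < u" "u \<le> n" "b - n + 2 * u \<le> l" "n \<le> b"
  shows "x = n + t - s - l"
proof -
  \<comment> \<open>\<open>y + u\<close> is the mirror image of \<open>b - s - 1\<close>, so the
    defect before the final run is reflected to the pair \<open>y\<close>,
    \<open>y + u\<close>.\<close>
  define y where "y = x + l + s - u"
  have refl_defect: "f y \<noteq> f (y + u)"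
  proof -
    have "f (b - s - 1) = f (y + u)" "f (b - s - 1 + u) = f y"
      using pal[of "b - s - 1"] pal[of "b - s - 1 + u"] assms(6-) unfolding y_def
      by (simp_all add: algebra_simps)
    then show ?thesis
      using defect_right by metis
  qed
  have refl_per: "f j = f (j + u)" if "x \<le> j" "j < y" for j
  proof -
    define i where "i = x + b + l - 1 - j - u"
    have "b - s \<le> i" "i + u < b + l" "x \<le> i"
      using that assms(6-) unfolding y_def i_def by linarith+
    then have "f i = f (i + u)" "f i = f (j + u)" "f (i + u) = f j"
      using per_right pal[of i] pal[of "i + u"] \<open>0 < u\<close> by (simp_all add: i_def)
    then show ?thesis
      by simp
  qed
  have "y \<ge> n + t - u"
    using per_left[of y] refl_defect assms(6-) unfolding y_def by fastforce
  \<comment> \<open>For larger \<open>y\<close> the reflected run would contain the defect at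
    \<open>n + t - u\<close>, unless the suffix starts to the right of it; in that case the lower
    bound on \<open>l\<close> makes the reflected run contain the defect at
    \<open>b - s - 1\<close>.\<close>
  moreover have "\<not> n + t - u < y"
  proof
    assume "n + t - u < y"
    moreover have "n + t - u + u = n + t"
      by simp
    ultimately have "n + t - u < x"
      using refl_per[of "n + t - u"] defect_left by fastforce
    then have "b - s - 1 < y"
      using assms(6-) unfolding y_def by linarith
    then show False
      using refl_per[of "b - s - 1"] defect_right assms(6-) by fastforce
  qed
  ultimately show ?thesis
    unfolding y_def by linarith
qed

text \<open>The \<open>- 1\<close> makes \<open>d\<close> equal to \<open>x + y\<close> for every
  half-open interval from \<open>x\<close> to \<open>y\<close> that the reflection maps to
  itself.\<close>

definition mirror_symmetric :: "(int \<Rightarrow> 'a) \<Rightarrow> int \<Rightarrow> bool" where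
  "mirror_symmetric f d \<longleftrightarrow> (\<forall>j. f (d - 1 - j) = f j)"

text \<open>Moving \<open>j\<close> by a period moves its mirror image by a period in the opposite
  direction, so one window of length \<open>length w\<close> decides.\<close>

lemma mirror_symmetric_periodic_extI:
  assumes "w \<noteq> []"
    and "\<And>j. x \<le> j \<Longrightarrow> j < x + int (length w) \<Longrightarrow> periodic_ext w (d - 1 - j) = periodic_ext w j"
  shows "mirror_symmetric (periodic_ext w) d"
  unfolding mirror_symmetric_def
proof
  fix j
  define k where "k = (j - x) div int (length w)"
  define i where "i = x + (j - x) mod int (length w)"
  have j: "j = i + k * int (length w)"
    unfolding i_def k_def by (metis add.assoc add.commute diff_add_cancel mod_div_mult_eq)
  have "periodic_ext w (d - 1 - i) = periodic_ext w i"
    using assms(1) by (intro assms(2)) (auto simp: i_def)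
  moreover have "periodic_ext w (d - 1 - j) = periodic_ext w (d - 1 - i)"
    using periodic_ext_diff_mult[of w "d - 1 - i" k] by (simp add: j algebra_simps)
  ultimately show "periodic_ext w (d - 1 - j) = periodic_ext w j"
    by (simp add: j)
qed

lemma palindrome_suffix_nth:
  assumes "palindrome v" "suffix v w" "int (length w - length v) \<le> j" "j < int (length w)"
  shows "w ! nat j = w ! nat (int (length w - length v) + int (length w) - 1 - j)"
proof -
  obtain r where w: "w = r @ v"
    using assms(2) by (auto simp: suffix_def)
  define k where "k = nat j - length r"
  have k: "k < length v" "nat j = length r + k"
    using assms(3,4) w unfolding k_def by (auto simp: nat_less_iff le_nat_iff)
  have "nat (int (length w - length v) + int (length w) - 1 - j) = length r + (length v - Suc k)"
    using k assms(3,4) w by auto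
  moreover have "v ! k = v ! (length v - Suc k)"
    using assms(1) k by (metis palindrome_def rev_nth)
  ultimately show ?thesis
    using k(2) by (simp only: w nth_append_length_plus)
qed

text \<open>Only the first and last \<open>q\<close> letters of the middle block \<open>Z\<close>
  are prescribed, so that the images of two-letter and three-letter words are both covered. The
  suffix supplied by richness starts before the final run, and
  \<open>palindromic_suffix_start\<close> locates it. The surplus \<open>e\<close> makes the initial
  power of \<open>U\<close> at least as long as the final run with its \<open>s\<close> extra
  letters.\<close>

lemma palindromic_suffix_center:
  fixes U Z :: "'a list" and g :: "int \<Rightarrow> 'a" and q s t :: int and n i e :: nat
  defines "N \<equiv> int (n * length U)" and "W \<equiv> word_pow U n @ Z @ word_pow U i"
  assumes agr: "max_agreement (periodic_ext U) g s t"
    and Z1: "\<And>j. 0 \<le> j \<Longrightarrow> j < q \<Longrightarrow> Z ! nat j = g j"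
    and Z2: "\<And>j. - q \<le> j \<Longrightarrow> j < 0 \<Longrightarrow> Z ! nat (int (length Z) + j) = g j"
    and q: "s < q" "t < q" "q \<le> int (length Z)"
    and n: "n = i + e" "s \<le> int (e * length U)" "length Z + 2 * length U \<le> i * length U"
    and "U \<noteq> []" "rich W"
  shows "\<And>j. N + t - s - int (i * length U) \<le> j \<Longrightarrow> j < int (length W) \<Longrightarrow>
           W ! nat j = W ! nat (2 * N + int (length Z) + t - s - 1 - j)"
proof -
  define f where "f = (\<lambda>j. W ! nat j)"
  define u where "u = int (length U)"
  define l where "l = int (i * length U)"
  define b where "b = N + int (length Z)"
  have st: "0 \<le> s" "0 \<le> t"
    using agr by (auto simp: max_agreement_def)
  have agree: "periodic_ext U j = g j" if "- s \<le> j" "j < t" for j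
    using agr that by (auto simp: max_agreement_def)
  have u: "0 < u"
    using \<open>U \<noteq> []\<close> by (simp add: u_def)
  have Nl: "N = l + int (e * length U)"
    unfolding N_def l_def using n(1) by (simp add: algebra_simps)
  have l: "int (length Z) + 2 * u \<le> l"
    unfolding l_def u_def using n(3) by linarith
  have "l \<le> N" "u \<le> N"
    using Nl l u by (smt (verit) of_nat_0_le_iff)+
  have len: "int (length W) = b + l"
    by (simp add: W_def b_def N_def l_def length_word_pow)
  have f1: "f j = periodic_ext U j" if "0 \<le> j" "j < N" for j
    using that nth_word_pow[of j n U] unfolding f_def W_def N_def
    by (simp add: nth_append_int length_word_pow)
  have f2: "f j = Z ! nat (j - N)" if "N \<le> j" "j < b" for j
    using that \<open>u \<le> N\<close> u unfolding f_def W_def N_def b_def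
    by (simp add: nth_append_int length_word_pow)
  have f3: "f j = periodic_ext U (j - b)" if "b \<le> j" "j < b + l" for j
    using that \<open>u \<le> N\<close> u nth_word_pow[of "j - b" i U] unfolding f_def W_def N_def b_def l_def
    by (simp add: nth_append_int length_word_pow algebra_simps)
  have gU: "periodic_ext U (j - N) = periodic_ext U j" for j
    unfolding N_def using periodic_ext_diff_mult[of U j "int n"] by simp
  have gl: "periodic_ext U (j - l) = periodic_ext U j" for j
    unfolding l_def using periodic_ext_diff_mult[of U j "int i"] by simp
  \<comment> \<open>The initial run continues for \<open>t\<close> letters into \<open>Z\<close>,
    where \<open>Z\<close> follows \<open>g\<close> and \<open>g\<close> still agrees with the
    extension of \<open>U\<close>. In the same way the final run starts \<open>s\<close> letters
    early.\<close>
  have left: "f j = periodic_ext U j" if "0 \<le> j" "j < N + t" for j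
  proof (cases "j < N")
    case False
    then show ?thesis
      using f2[of j] Z1[of "j - N"] agree[of "j - N"] gU[of j] that q st by (simp add: b_def)
  qed (use f1 that in auto)
  have right_Z: "f j = g (j - b)" if "b - q \<le> j" "j < b" for j
    using f2[of j] Z2[of "j - b"] that q by (simp add: b_def)
  have right: "f j = periodic_ext U (j - b)" if "b - s \<le> j" "j < b + l" for j
  proof (cases "j < b")
    case True
    then show ?thesis
      using right_Z[of j] agree[of "j - b"] that q st by simp
  qed (use f3 that in auto)
  have "W \<noteq> []"
    using len u l \<open>u \<le> N\<close> b_def by auto
  then obtain W' y where W': "W = W' @ [y]"
    by (metis rev_exhaust)
  then obtain v where v: "palindrome v" "suffix v W" "\<not> sublist v W'"
    using rich_obtain_new_suffix \<open>rich W\<close> by metis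
  define x where "x = int (length W - length v)"
  have lv: "length v \<le> length W"
    using v(2) by (rule suffix_length_le)
  have pal: "f j = f (x + b + l - 1 - j)" if "x \<le> j" "j < b + l" for j
    using palindrome_suffix_nth[OF v(1,2), of j] that len unfolding f_def x_def
    by (simp add: algebra_simps)
  \<comment> \<open>Otherwise \<open>v\<close> would lie in the final run, hence be a suffix of
    \<open>word_pow U n\<close>, and so occur in \<open>W'\<close>.\<close>
  have "x < b - s"
  proof (rule ccontr)
    assume "\<not> x < b - s"
    define k where "k = n * length U - length v"
    have x: "x = b + l - int (length v)"
      using lv len by (simp add: x_def)
    have "int (length v) \<le> N"
      using x \<open>\<not> x < b - s\<close> n(2) Nl by linarith
    then have k: "k + length v = n * length U" "int k = N - int (length v)"
      unfolding k_def N_def by linarith+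
    obtain r where r: "W = r @ v"
      using v(2) by (auto simp: suffix_def)
    have "v = take (length v) (drop k (word_pow U n))"
    proof (rule nth_equalityI)
      show "length v = length (take (length v) (drop k (word_pow U n)))"
        using k by (simp add: length_word_pow)
      fix h assume h: "h < length v"
      have "v ! h = f (x + int h)"
        using h by (simp add: f_def x_def r nat_add_distrib)
      also have "\<dots> = periodic_ext U (x + int h - b)"
        using \<open>\<not> x < b - s\<close> h len lv by (intro right) (auto simp: x_def)
      also have "\<dots> = periodic_ext U (int k + int h)"
        using gU[of "int k + int h"] gl[of "x + int h - b"] unfolding k(2) x
        by (simp add: algebra_simps)
      also have "\<dots> = word_pow U n ! (k + h)"
      proof -
        have "int k + int h < int (n * length U)" "nat (int k + int h) = k + h"
          using h k(1) by linarith+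
        then show ?thesis
          using nth_word_pow[of "int k + int h" n U] by (metis of_nat_0_le_iff of_nat_add)
      qed
      finally show "v ! h = take (length v) (drop k (word_pow U n)) ! h"
        using h k by (simp add: length_word_pow)
    qed
    then have "sublist v (word_pow U n)"
      by (metis sublist_drop sublist_order.order_trans sublist_take)
    moreover have "prefix (word_pow U n) W'"
    proof -
      have "prefix (word_pow U n) (W' @ [y])"
        unfolding W'[symmetric] W_def by simp
      moreover have "int (length (word_pow U n)) = N"
        by (simp add: length_word_pow N_def)
      then have "word_pow U n \<noteq> W"
        using len b_def l u by force
      ultimately show ?thesis
        unfolding W' prefix_snoc by blast
    qed
    ultimately show False
      using v(3) by (meson prefix_imp_sublist sublist_order.order_trans)
  qed
  have "x = N + t - s - l"
  proof (rule palindromic_suffix_start[where f = f and u = u and b = b])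
    show "f j = f (j + u)" if "0 \<le> j" "j < N + t - u" for j
      using left[of j] left[of "j + u"] that u by (simp add: u_def)
    show "f (N + t - u) \<noteq> f (N + t)"
    proof -
      have "f (N + t - u) = periodic_ext U t"
        using left[of "N + t - u"] gU[of "N + t"] \<open>u \<le> N\<close> st u by (simp add: u_def)
      moreover have "f (N + t) = g t"
        using f2[of "N + t"] Z1[of t] st q by (simp add: b_def)
      ultimately show ?thesis
        using agr by (simp add: max_agreement_def)
    qed
    show "f j = f (j + u)" if "b - s \<le> j" "j + u < b + l" for j
      using right[of j] right[of "j + u"] that u periodic_ext_add[of U "j - b"]
      by (simp add: u_def algebra_simps)
    show "f (b - s - 1) \<noteq> f (b - s - 1 + u)"
    proof -
      have "f (b - s - 1 + u) = periodic_ext U (b - s - 1 + u - b)"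
        using u l st by (intro right) auto
      also have "b - s - 1 + u - b = - s - 1 + int (length U)"
        by (simp add: u_def)
      finally have "f (b - s - 1 + u) = periodic_ext U (- s - 1)"
        by (simp only: periodic_ext_add)
      moreover have "f (b - s - 1) = g (- s - 1)"
        using right_Z[of "b - s - 1"] st q by simp
      ultimately show ?thesis
        using agr by (auto simp: max_agreement_def)
    qed
    show "f j = f (x + b + l - 1 - j)" if "x \<le> j" "j < b + l" for j
      using that by (rule pal)
  qed (use \<open>x < b - s\<close> st u \<open>u \<le> N\<close> l in \<open>auto simp: b_def x_def\<close>)
  then have eq: "x + b + l - 1 - j = 2 * N + int (length Z) + t - s - 1 - j" for j
    by (simp add: b_def)
  fix j assume "N + t - s - int (i * length U) \<le> j" "j < int (length W)"
  then show "W ! nat j = W ! nat (2 * N + int (length Z) + t - s - 1 - j)"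
    using pal[of j] \<open>x = N + t - s - l\<close> unfolding eq unfolding f_def l_def len by blast
qed

lemma le_mult_length:
  assumes "w \<noteq> []"
  shows "k \<le> k * length w"
  using assms by (cases w) auto

lemma nth_word_pow_end:
  assumes "- int (n * length w) \<le> j" "j < 0"
  shows "word_pow w n ! nat (int (n * length w) + j) = periodic_ext w j"
  using nth_word_pow[of "int (n * length w) + j" n w] periodic_ext_add_mult(1)[of w j "int n"] assms
  by (simp add: algebra_simps)

text \<open>With a power of \<open>V\<close> longer than \<open>s\<close> and \<open>t\<close> as
  middle block, the reflection of \<open>palindromic_suffix_center\<close> links the two outer
  powers of \<open>U\<close>. Relative to the ends of the middle block it sends \<open>j\<close> to
  \<open>t - s - 1 - j\<close>.\<close>

lemma mirror_symmetric_of_rich: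
  assumes agr: "max_agreement (periodic_ext U) (periodic_ext V) s t"
    and "U \<noteq> []" "V \<noteq> []"
    and rich: "\<And>n m i. 0 < m \<Longrightarrow> i \<le> n \<Longrightarrow> rich (word_pow U n @ word_pow V m @ word_pow U i)"
  shows "mirror_symmetric (periodic_ext U) (t - s)"
proof -
  define m where "m = nat (s + t + 1)"
  define Z where "Z = word_pow V m"
  \<comment> \<open>Ensures \<open>length Z + 2 * length U \<le> i * length U\<close>;
    \<open>e\<close> then supplies the \<open>s\<close> surplus letters.\<close>
  define i where "i = length Z + 2"
  define e where "e = nat s"
  define n where "n = i + e"
  define N where "N = int (n * length U)"
  define W where "W = word_pow U n @ Z @ word_pow U i"
  have st: "0 \<le> s" "0 \<le> t"
    using agr by (auto simp: max_agreement_def)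
  have lenZ: "length Z = m * length V"
    by (simp add: Z_def length_word_pow)
  then have q: "s < int (length Z)" "t < int (length Z)"
    using le_mult_length[OF \<open>V \<noteq> []\<close>, of m] st unfolding m_def by linarith+
  have e: "s \<le> int (e * length U)"
    using le_mult_length[OF \<open>U \<noteq> []\<close>, of e] st unfolding e_def by linarith
  have i: "length Z + 2 * length U \<le> i * length U"
    using le_mult_length[OF \<open>U \<noteq> []\<close>, of "length Z"] by (simp add: i_def algebra_simps)
  have "0 < m"
    using st by (simp add: m_def)
  then have "rich W"
    unfolding W_def Z_def by (intro rich) (auto simp: n_def)
  have center: "W ! nat j = W ! nat (2 * N + int (length Z) + t - s - 1 - j)"
    if "N + t - s - int (i * length U) \<le> j" "j < int (length W)" for j
    unfolding N_def W_def
  proof (rule palindromic_suffix_center[where q = "int (length Z)", OF agr])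
    show "Z ! nat j = periodic_ext V j" if "0 \<le> j" "j < int (length Z)" for j
      using that nth_word_pow[of j m V] lenZ by (simp add: Z_def)
    show "Z ! nat (int (length Z) + j) = periodic_ext V j" if "- int (length Z) \<le> j" "j < 0" for j
      using that nth_word_pow_end[of m V j] lenZ by (simp add: Z_def)
    show "n = i + e"
      by (rule n_def)
  qed (use that q e i \<open>U \<noteq> []\<close> \<open>rich W\<close> in \<open>auto simp: N_def W_def\<close>)
  have "int (i * length U) \<le> N"
    by (simp add: N_def n_def algebra_simps)
  have i': "int (length Z) + 2 * int (length U) \<le> int (i * length U)"
    using i by linarith
  have lenW: "int (length W) = N + int (length Z) + int (i * length U)"
    by (simp add: W_def N_def length_word_pow)
  show ?thesis
  proof (rule mirror_symmetric_periodic_extI[OF \<open>U \<noteq> []\<close>, of "max 0 (t - s)"])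
    \<comment> \<open>Over one period from \<open>max 0 (t - s)\<close> on, \<open>j\<close> lies in
      the final power of \<open>U\<close> and its mirror image in the initial one, so both letters
      are read off \<open>periodic_ext U\<close>.\<close>
    fix j assume j: "max 0 (t - s) \<le> j" "j < max 0 (t - s) + int (length U)"
    then have "0 \<le> j" "t - s \<le> j" "j < int (i * length U)" "0 \<le> N + (t - s - 1 - j)"
      using st q i' \<open>int (i * length U) \<le> N\<close> by linarith+
    have "W ! nat (N + int (length Z) + j) = periodic_ext U j"
      using nth_word_pow[of j i U] \<open>0 \<le> j\<close> \<open>j < int (i * length U)\<close>
      by (simp add: W_def nth_append_int length_word_pow N_def)
    moreover have "W ! nat (N + (t - s - 1 - j)) = periodic_ext U (N + (t - s - 1 - j))"
      using nth_word_pow[of "N + (t - s - 1 - j)" n U] \<open>t - s \<le> j\<close> \<open>0 \<le> N + (t - s - 1 - j)\<close>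
      by (simp add: W_def nth_append_int length_word_pow N_def)
    moreover have "periodic_ext U (N + (t - s - 1 - j)) = periodic_ext U (t - s - 1 - j)"
      using periodic_ext_add_mult(1)[of U "t - s - 1 - j" "int n"] by (simp add: N_def algebra_simps)
    moreover have "W ! nat (N + int (length Z) + j) = W ! nat (N + (t - s - 1 - j))"
      using center[of "N + int (length Z) + j"] lenW \<open>0 \<le> j\<close> \<open>j < int (i * length U)\<close> st q i'
      by (simp add: algebra_simps)
    ultimately show "periodic_ext U (t - s - 1 - j) = periodic_ext U j"
      by simp
  qed
qed

section \<open>Comparison of the axes for three letters\<close>

text \<open>A reflection that moves a maximal run only slightly must fix it, since otherwise an end of the
  run would be mapped into its interior.\<close>

lemma reflected_run_center:
  fixes h :: "int \<Rightarrow> 'a" and d k m s t w :: int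
  assumes per: "\<And>j. - s \<le> j \<Longrightarrow> j + w < k + t \<Longrightarrow> h j = h (j + w)"
    and defect_left: "h (- s - 1) \<noteq> h (- s - 1 + w)"
    and defect_right: "h (k + t - w) \<noteq> h (k + t)"
    and refl: "\<And>j. - m \<le> j \<Longrightarrow> j < k + m \<Longrightarrow> h j = h (k + d - 1 - j)"
    and "0 \<le> s" "0 \<le> t" "s < m" "t < m" "0 < w" "w + \<bar>d\<bar> \<le> k"
  shows "d = t - s"
proof (rule antisym)
  show "d \<le> t - s"
  proof (rule ccontr)
    assume "\<not> d \<le> t - s"
    \<comment> \<open>The mirror image of the defect at the right end falls inside the run; below,
      the left end is treated in the same way.\<close>
    then have "h (d - 1 - t) = h (d - 1 - t + w)"
      using assms(5-) by (intro per) auto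
    moreover have "h (k + t - w) = h (d - 1 - t + w)" "h (k + t) = h (d - 1 - t)"
      using refl[of "k + t - w"] refl[of "k + t"] assms(5-) by (simp_all add: algebra_simps)
    ultimately show False
      using defect_right by simp
  qed
  show "t - s \<le> d"
  proof (rule ccontr)
    assume "\<not> t - s \<le> d"
    then have "h (k + d + s - w) = h (k + d + s - w + w)"
      using assms(5-) by (intro per) auto
    moreover have "h (- s - 1) = h (k + d + s)" "h (- s - 1 + w) = h (k + d + s - w)"
      using refl[of "- s - 1"] refl[of "- s - 1 + w"] assms(5-) by (simp_all add: algebra_simps)
    ultimately show False
      using defect_left by simp
  qed
qed

text \<open>On the middle block, the reflection of \<open>palindromic_suffix_center\<close> is the
  reversal of the block followed by a shift by \<open>t - s\<close>. By
  \<open>reflected_run_center\<close> it must fix the central run of \<open>X\<close>, which extends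
  by \<open>s'\<close> and \<open>t'\<close> letters into the neighbouring powers of
  \<open>V\<close>.\<close>

lemma agreement_centers_eq_of_rich:
  assumes agr: "max_agreement (periodic_ext U) (periodic_ext V) s t"
    and agr': "max_agreement (periodic_ext V) (periodic_ext X) s' t'"
    and "U \<noteq> []" "V \<noteq> []" "X \<noteq> []"
    and rich: "\<And>n m k i. 0 < m \<Longrightarrow> 0 < k \<Longrightarrow> i \<le> n \<Longrightarrow>
      rich (word_pow U n @ (word_pow V m @ word_pow X k @ word_pow V m) @ word_pow U i)"
  shows "t - s = t' - s'"
proof -
  \<comment> \<open>Large enough for the extensions of all runs to end inside the powers of
    \<open>V\<close>.\<close>
  define m where "m = nat (s + t + s' + t' + 1)"
  \<comment> \<open>Large enough for the length condition of \<open>reflected_run_center\<close>, as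
    \<open>\<bar>t - s\<bar> \<le> s + t\<close>.\<close>
  define k where "k = nat (s + t + 1)"
  define Z where "Z = word_pow V m @ word_pow X k @ word_pow V m"
  define i where "i = length Z + 2"
  define e where "e = nat s"
  define n where "n = i + e"
  define N where "N = int (n * length U)"
  define W where "W = word_pow U n @ Z @ word_pow U i"
  define M where "M = int (m * length V)"
  define K where "K = int (k * length X)"
  have st: "0 \<le> s" "0 \<le> t" "0 \<le> s'" "0 \<le> t'"
    using agr agr' by (auto simp: max_agreement_def)
  have lenZ: "int (length Z) = 2 * M + K"
    by (simp add: Z_def length_word_pow M_def K_def)
  have "s + t + s' + t' + 1 \<le> M"
    using le_mult_length[OF \<open>V \<noteq> []\<close>, of m] st unfolding M_def m_def by linarith
  then have M: "s < M" "t < M" "s' < M" "t' < M"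
    using st by linarith+
  have K: "int (length X) + \<bar>t - s\<bar> \<le> K"
  proof -
    have "K = int (nat (s + t) * length X) + int (length X)"
      using st by (simp add: K_def k_def nat_add_distrib algebra_simps)
    then show ?thesis
      using le_mult_length[OF \<open>X \<noteq> []\<close>, of "nat (s + t)"] st by linarith
  qed
  have e: "s \<le> int (e * length U)"
    using le_mult_length[OF \<open>U \<noteq> []\<close>, of e] st unfolding e_def by linarith
  have i: "length Z + 2 * length U \<le> i * length U"
    using le_mult_length[OF \<open>U \<noteq> []\<close>, of "length Z"] by (simp add: i_def algebra_simps)
  have "0 < m" "0 < k"
    using st by (simp_all add: m_def k_def)
  then have "rich W"
    unfolding W_def Z_def by (intro rich) (auto simp: n_def)
  have len: "int (length (word_pow V m)) = M" "int (length (word_pow X k)) = K"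
    by (simp_all add: length_word_pow M_def K_def)
  have KM: "0 \<le> M" "0 \<le> K"
    by (simp_all add: M_def K_def)
  have Z1: "Z ! nat j = periodic_ext V j" if "0 \<le> j" "j < M" for j
    using that nth_word_pow[of j m V] unfolding Z_def M_def
    by (simp add: nth_append_int length_word_pow)
  have Z2: "Z ! nat (M + j) = periodic_ext X j" if "0 \<le> j" "j < K" for j
    using that nth_word_pow[of j k X] unfolding Z_def M_def K_def
    by (simp add: nth_append_int length_word_pow)
  have Z3: "Z ! nat (M + K + j) = periodic_ext V j" if "0 \<le> j" "j < M" for j
  proof -
    have "Z ! nat (M + K + j) = word_pow V m ! nat j"
      unfolding Z_def using that KM by (simp add: nth_append_int len)
    then show ?thesis
      using that nth_word_pow[of j m V] by (simp add: M_def)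
  qed
  have perV: "periodic_ext V (M + j) = periodic_ext V j" for j
    unfolding M_def using periodic_ext_add_mult(1)[of V j "int m"] by (simp add: algebra_simps)
  have perX: "periodic_ext X (K + j) = periodic_ext X j" for j
    unfolding K_def using periodic_ext_add_mult(1)[of X j "int k"] by (simp add: algebra_simps)
  have center: "W ! nat j = W ! nat (2 * N + int (length Z) + t - s - 1 - j)"
    if "N + t - s - int (i * length U) \<le> j" "j < int (length W)" for j
    unfolding N_def W_def
  proof (rule palindromic_suffix_center[where q = M, OF agr])
    show "Z ! nat j = periodic_ext V j" if "0 \<le> j" "j < M" for j
      using that Z1 by blast
    show "Z ! nat (int (length Z) + j) = periodic_ext V j" if "- M \<le> j" "j < 0" for j
      using that Z3[of "M + j"] perV lenZ by (simp add: algebra_simps)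
    show "M \<le> int (length Z)"
      using lenZ M K st by linarith
    show "n = i + e"
      by (rule n_def)
  qed (use that M e i \<open>U \<noteq> []\<close> \<open>rich W\<close> in \<open>auto simp: N_def W_def\<close>)
  have i': "int (length Z) + 2 * int (length U) \<le> int (i * length U)"
    using i by linarith
  have lenW: "int (length W) = N + int (length Z) + int (i * length U)"
    by (simp add: W_def N_def length_word_pow)
  \<comment> \<open>\<open>W\<close> with the origin moved to the start of the central power of
    \<open>X\<close>.\<close>
  define h where "h = (\<lambda>j. W ! nat (N + M + j))"
  have "0 \<le> N"
    by (simp add: N_def)
  have hZ: "h j = Z ! nat (M + j)" if "- M \<le> j" "j < K + M" for j
  proof -
    have "int (length (word_pow U n)) = N"
      by (simp add: length_word_pow N_def)
    then show ?thesis
      using that \<open>0 \<le> N\<close> lenZ unfolding h_def W_def by (simp add: nth_append_int)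
  qed
  have hX: "h j = periodic_ext X j" if "- s' \<le> j" "j < K + t'" for j
  proof -
    consider "j < 0" | "0 \<le> j" "j < K" | "K \<le> j"
      by linarith
    then show ?thesis
    proof cases
      case 1
      then show ?thesis
        using hZ[of j] Z1[of "M + j"] perV[of j] agr' that M K st by (simp add: max_agreement_def)
    next
      case 2
      then show ?thesis
        using hZ[of j] Z2[of j] M st by simp
    next
      case 3
      then show ?thesis
        using hZ[of j] Z3[of "j - K"] perX[of "j - K"] agr' that M K st
        by (simp add: max_agreement_def)
    qed
  qed
  show ?thesis
  proof (rule reflected_run_center[where h = h and w = "int (length X)" and k = K and m = M])
    show "h j = h (j + int (length X))" if "- s' \<le> j" "j + int (length X) < K + t'" for j
      using that hX[of j] hX[of "j + int (length X)"] by simp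
    have "h (- s' - 1) = periodic_ext V (- s' - 1)"
      using hZ[of "- s' - 1"] Z1[of "M - s' - 1"] perV[of "- s' - 1"] M st K by (simp add: algebra_simps)
    moreover have "0 < length X"
      using \<open>X \<noteq> []\<close> by simp
    then have "h (- s' - 1 + int (length X)) = periodic_ext X (- s' - 1)"
      using hX[of "- s' - 1 + int (length X)"] periodic_ext_add[of X "- s' - 1"] st K by simp
    ultimately show "h (- s' - 1) \<noteq> h (- s' - 1 + int (length X))"
      using agr' by (simp add: max_agreement_def)
    have "h (K + t') = periodic_ext V t'"
      using hZ[of "K + t'"] Z3[of t'] M st K by (simp add: algebra_simps)
    moreover have "h (K + t' - int (length X)) = periodic_ext X t'"
      using hX[of "K + t' - int (length X)"] perX[of t'] \<open>0 < length X\<close> st K by simp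
    ultimately show "h (K + t' - int (length X)) \<noteq> h (K + t')"
      using agr' by (auto simp: max_agreement_def)
    show "h j = h (K + (t - s) - 1 - j)" if "- M \<le> j" "j < K + M" for j
    proof -
      have "N + t - s - int (i * length U) \<le> N + M + j" "N + M + j < int (length W)"
        using lenW lenZ i' M KM st that by linarith+
      from center[OF this] show ?thesis
        unfolding h_def lenZ by (simp add: algebra_simps)
    qed
  qed (use M st K \<open>X \<noteq> []\<close> in auto)
qed

text \<open>Serves the one-letter alphabet, where there is no pair of letters. The new palindromic
  suffix is longer than \<open>U\<close>, so it covers a full period and its centre is an axis of
  the whole periodic word.\<close>

lemma mirror_symmetric_of_rich_square:
  assumes "U \<noteq> []" "rich (U @ U)"
  shows "\<exists>d\<ge>0. mirror_symmetric (periodic_ext U) d"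
proof -
  obtain U' y where U': "U = U' @ [y]"
    using assms(1) by (metis rev_exhaust)
  then obtain v where v: "palindrome v" "suffix v (U @ U)" "\<not> sublist v (U @ U')"
    using rich_obtain_new_suffix[of "U @ U'" y] assms(2) by auto
  \<comment> \<open>A suffix no longer than \<open>U\<close> would already occur in the first copy
    of \<open>U\<close>.\<close>
  have len: "length U < length v"
  proof (rule ccontr)
    assume "\<not> length U < length v"
    then have "suffix v U"
      using v(2) by (meson not_less suffix_length_suffix suffixI)
    then show False
      using v(3) by (meson sublist_append_rightI sublist_order.order_trans suffix_imp_sublist)
  qed
  define x where "x = int (length (U @ U) - length v)"
  have le: "length v \<le> length (U @ U)"
    using v(2) by (rule suffix_length_le)
  have nth: "(U @ U) ! nat j = periodic_ext U j" if "0 \<le> j" "j < 2 * int (length U)" for j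
    using nth_word_pow[of j 2 U] that by (simp add: numeral_2_eq_2)
  have "mirror_symmetric (periodic_ext U) (x + 2 * int (length U))"
  proof (rule mirror_symmetric_periodic_extI[OF assms(1), of x])
    fix j assume j: "x \<le> j" "j < x + int (length U)"
    then have "0 \<le> j" "j < 2 * int (length U)"
      using len le by (auto simp: x_def)
    moreover have "0 \<le> x + 2 * int (length U) - 1 - j" "x + 2 * int (length U) - 1 - j < 2 * int (length U)"
      using j calculation by (auto simp: x_def)
    moreover have "(U @ U) ! nat j = (U @ U) ! nat (x + 2 * int (length U) - 1 - j)"
      using palindrome_suffix_nth[OF v(1,2), of j] j calculation unfolding x_def
      by (simp add: algebra_simps)
    ultimately show "periodic_ext U (x + 2 * int (length U) - 1 - j) = periodic_ext U j"
      using nth by simp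
  qed
  then show ?thesis
    by (intro exI[of _ "x + 2 * int (length U)"]) (simp add: x_def)
qed

section \<open>Construction of the class P presentation\<close>

definition segment :: "(int \<Rightarrow> 'a) \<Rightarrow> int \<Rightarrow> int \<Rightarrow> 'a list" where
  "segment f x y = map f [x..y - 1]"

lemma length_segment: "length (segment f x y) = nat (y - x)"
  by (simp add: segment_def)

lemma nth_segment: "int k < y - x \<Longrightarrow> segment f x y ! k = f (x + int k)"
  by (simp add: segment_def)

lemma segment_append:
  assumes "x \<le> y" "y \<le> z"
  shows "segment f x y @ segment f y z = segment f x z"
proof (cases "y = z")
  case False
  then show ?thesis
    using assms upto_split1[of x y "z - 1"] by (simp add: segment_def flip: map_append)
qed (simp add: segment_def)

lemma segment_cong:
  "(\<And>j. x \<le> j \<Longrightarrow> j < y \<Longrightarrow> f j = g j) \<Longrightarrow> segment f x y = segment g x y"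
  by (simp add: segment_def)

lemma palindrome_segment:
  assumes "mirror_symmetric f (x + y)"
  shows "palindrome (segment f x y)"
  unfolding palindrome_def
proof (rule nth_equalityI)
  fix k assume "k < length (rev (segment f x y))"
  then have k: "int k < y - x"
    by (simp add: length_segment)
  then have "rev (segment f x y) ! k = f (x + (y - x - 1 - int k))"
    by (simp add: rev_nth length_segment nth_segment of_nat_diff)
  also have "\<dots> = f (x + y - 1 - (x + int k))"
    by (simp add: algebra_simps)
  also have "\<dots> = f (x + int k)"
    using assms unfolding mirror_symmetric_def by metis
  finally show "rev (segment f x y) ! k = segment f x y ! k"
    using k by (simp add: nth_segment)
qed simp

lemma segment_periodic_ext: "segment (periodic_ext w) 0 (int (length w)) = w"
proof (rule nth_equalityI)
  fix k assume "k < length (segment (periodic_ext w) 0 (int (length w)))"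
  then have "k < length w"
    by (simp add: length_segment)
  then show "segment (periodic_ext w) 0 (int (length w)) ! k = w ! k"
    using nth_periodic_ext[of "int k" w] by (simp add: nth_segment)
qed (simp add: length_segment)

lemma segment_periodic_ext_shift:
  "segment (periodic_ext w) (x + int (length w)) (y + int (length w)) = segment (periodic_ext w) x y"
proof (rule nth_equalityI)
  fix k assume "k < length (segment (periodic_ext w) (x + int (length w)) (y + int (length w)))"
  then have "int k < y - x"
    by (simp add: length_segment)
  then show "segment (periodic_ext w) (x + int (length w)) (y + int (length w)) ! k
    = segment (periodic_ext w) x y ! k"
    using periodic_ext_add[of w "x + int k"] by (simp add: nth_segment algebra_simps)
qed (simp add: length_segment)

text \<open>The reflection is composed with the translation by one period.\<close>

lemma mirror_symmetric_shift:
  "mirror_symmetric (periodic_ext w) d \<Longrightarrow> mirror_symmetric (periodic_ext w) (d + int (length w))"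
  unfolding mirror_symmetric_def
  using periodic_ext_add[of w] by (metis (no_types, lifting) diff_add_eq)

lemma of_word_append: "of_word (u @ v) = of_word u \<otimes>\<^bsub>free_group\<^esub> of_word v"
  unfolding free_group_def by simp (transfer, simp)

text \<open>All \<open>g x\<close> share the palindrome \<open>p\<close> on the interval from
  \<open>-s\<close> to \<open>t\<close>. The conjugate \<open>r x\<close> of
  \<open>\<phi> [x]\<close> is one period read from \<open>-s\<close>; it is \<open>p\<close>
  prolonged or shortened by the stretch between \<open>t\<close> and \<open>u x - s\<close>. The
  ends of this stretch add up to \<open>t - s + u x\<close>, again a symmetry parameter of
  \<open>g x\<close>, so it is a palindrome.\<close>

lemma class_P_of_common_symmetry:
  fixes \<phi> :: "'a list \<Rightarrow> 'b list" and s t :: int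
  assumes "word_morphism \<phi>" "non_erasing \<phi>" "0 \<le> s" "0 \<le> t"
    and agree: "\<And>x y j. - s \<le> j \<Longrightarrow> j < t \<Longrightarrow> periodic_ext (\<phi> [x]) j = periodic_ext (\<phi> [y]) j"
    and sym: "\<And>x. mirror_symmetric (periodic_ext (\<phi> [x])) (t - s)"
  shows "class_P \<phi>"
proof -
  interpret F: group "free_group :: 'b free_grp monoid"
    by (rule group_free_group)
  have [simp]: "g \<in> carrier free_group" for g :: "'b free_grp"
    by (simp add: free_group_def)
  define g where "g x = periodic_ext (\<phi> [x])" for x
  define u where "u x = int (length (\<phi> [x]))" for x
  \<comment> \<open>\<open>undefined\<close> serves as an arbitrary letter: by \<open>agree\<close>
    these segments are the same for all letters.\<close>
  define p where "p = segment (g undefined) (- s) t"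
  define p' where "p' = segment (g undefined) (- s) 0"
  define p'' where "p'' = segment (g undefined) 0 t"
  define r where "r x = segment (g x) (- s) (u x - s)" for x
  define \<psi> where "\<psi> w = concat (map r w)" for w
  define q where "q x = (if u x \<le> s + t then inv\<^bsub>free_group\<^esub> (of_word (segment (g x) (u x - s) t))
    else of_word (segment (g x) t (u x - s)))" for x
  have u: "0 < u x" for x
    using assms(2) by (simp add: u_def non_erasing_def)
  have p: "p = segment (g x) (- s) t" and p': "p' = segment (g x) (- s) 0" for x
    unfolding p_def p'_def g_def using agree \<open>0 \<le> t\<close> by (intro segment_cong; fastforce)+
  have split: "p = p' @ p''"
    unfolding p_def p'_def p''_def using assms by (simp add: segment_append)
  have pal_p: "palindrome p"
    unfolding p_def g_def by (rule palindrome_segment) (use sym in simp)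
  have sym': "mirror_symmetric (g x) (t - s + u x)" for x
    unfolding g_def u_def by (rule mirror_symmetric_shift[OF sym])
  have tail: "P_tail p (q x)" for x
  proof (cases "u x \<le> s + t")
    case True
    let ?\<pi> = "segment (g x) (u x - s) t"
    have "palindrome ?\<pi>"
      by (rule palindrome_segment) (use sym'[of x] in \<open>simp add: algebra_simps\<close>)
    moreover have "p = r x @ ?\<pi>"
      using True u[of x] by (simp add: p[of x] r_def segment_append)
    \<comment> \<open>This makes the palindromic suffix proper and \<open>p\<close> non-empty, as
      the inverse case of \<open>P_tail\<close> demands.\<close>
    moreover have "r x \<noteq> []"
      using u[of x] length_segment[of "g x" "- s" "u x - s"] by (auto simp: r_def)
    ultimately have "palindrome ?\<pi> \<and> strict_suffix ?\<pi> p \<and> q x = inv\<^bsub>free_group\<^esub> (of_word ?\<pi>)"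
      and "p \<noteq> []"
      using True by (auto simp: q_def strict_suffix_def suffix_def)
    then show ?thesis
      unfolding P_tail_def by blast
  next
    case False
    have "palindrome (segment (g x) t (u x - s))"
      by (rule palindrome_segment) (use sym'[of x] in \<open>simp add: algebra_simps\<close>)
    then show ?thesis
      using False by (auto simp: P_tail_def q_def)
  qed
  have pq: "of_word (r x) = of_word p \<otimes>\<^bsub>free_group\<^esub> q x" for x
  proof (cases "u x \<le> s + t")
    case True
    then have "p = r x @ segment (g x) (u x - s) t"
      using u[of x] by (simp add: p[of x] r_def segment_append)
    then show ?thesis
      using True by (simp add: of_word_append q_def F.m_assoc)
  next
    case False
    then have "r x = p @ segment (g x) t (u x - s)"
      using assms by (simp add: p[of x] r_def segment_append)
    then show ?thesis
      using False by (simp add: of_word_append q_def)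
  qed
  have "standard_P_with p q \<psi>"
    using pal_p tail pq by (simp add: standard_P_with_def word_morphism_def \<psi>_def)
  moreover have "of_word (\<phi> [x]) = of_word p'' \<otimes>\<^bsub>free_group\<^esub> q x \<otimes>\<^bsub>free_group\<^esub> of_word p'" for x
  proof -
    \<comment> \<open>By periodicity \<open>p'\<close> is also the segment from
      \<open>u x - s\<close> to \<open>u x\<close>, which gives
      \<open>r x @ p' = p' @ \<phi> [x]\<close>; cancelling \<open>p'\<close> in the free group
      yields the factorization.\<close>
    have "r x @ p' = segment (g x) (- s) (u x - s) @ segment (g x) (u x - s) (u x)"
      using segment_periodic_ext_shift[of "\<phi> [x]" "- s" 0] by (simp add: r_def p'[of x] g_def u_def)
    also have "\<dots> = segment (g x) (- s) (u x)"
      using u[of x] assms by (intro segment_append) auto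
    also have "\<dots> = segment (g x) (- s) 0 @ segment (g x) 0 (u x)"
      using u[of x] assms by (simp add: segment_append)
    also have "\<dots> = p' @ \<phi> [x]"
      using segment_periodic_ext[of "\<phi> [x]"] by (simp add: p'[of x] g_def u_def)
    finally have "of_word (r x) \<otimes>\<^bsub>free_group\<^esub> of_word p' = of_word p' \<otimes>\<^bsub>free_group\<^esub> of_word (\<phi> [x])"
      by (metis of_word_append)
    then have "of_word p' \<otimes>\<^bsub>free_group\<^esub> (of_word p'' \<otimes>\<^bsub>free_group\<^esub> q x \<otimes>\<^bsub>free_group\<^esub> of_word p')
      = of_word p' \<otimes>\<^bsub>free_group\<^esub> of_word (\<phi> [x])"
      by (simp add: pq split of_word_append F.m_assoc)
    then show ?thesis
      using F.Units_l_cancel by simp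
  qed
  ultimately show ?thesis
    unfolding class_P_def using assms(1) split by blast
qed

section \<open>From the axes of all pairs of letters to class P\<close>

lemma word_morphism_replicate:
  assumes "word_morphism \<phi>"
  shows "\<phi> (replicate n a) = word_pow (\<phi> [a]) n"
proof (induction n)
  case 0
  then show ?case
    using assms by (simp add: word_morphism_def)
next
  case (Suc n)
  have "\<phi> (replicate (Suc n) a) = \<phi> ([a] @ replicate n a)"
    by simp
  also have "\<dots> = \<phi> [a] @ \<phi> (replicate n a)"
    using assms by (simp only: word_morphism_def)
  finally show ?case
    using Suc by simp
qed

theorem theorem6p29:
  fixes \<phi> :: "'a::finite list \<Rightarrow> 'a list"
  assumes "word_morphism \<phi>"
    and "non_erasing \<phi>"
    and "\<And>x y. x \<noteq> y \<Longrightarrow> \<phi> [x] \<noteq> \<phi> [y]"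
    and "\<And>x. primitive (\<phi> [x])"
    and "\<And>(a::'a) (b::'a) (c::'a) (\<alpha>::int) (\<beta>::int) (\<gamma>::int).
           a \<noteq> b \<Longrightarrow> a \<noteq> c \<Longrightarrow> b \<noteq> c \<Longrightarrow>
           of_word (\<phi> [a]) [^]\<^bsub>free_group\<^esub> \<alpha> \<otimes>\<^bsub>free_group\<^esub>
           of_word (\<phi> [b]) [^]\<^bsub>free_group\<^esub> \<beta> \<otimes>\<^bsub>free_group\<^esub>
           of_word (\<phi> [c]) [^]\<^bsub>free_group\<^esub> \<gamma> = \<one>\<^bsub>free_group\<^esub> \<Longrightarrow>
           \<alpha> * \<beta> * \<gamma> = 0"
    and "preserves_richness \<phi>"
  shows "class_P \<phi>"
proof -
  have append: "\<phi> (v @ w) = \<phi> v @ \<phi> w" for v w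
    using assms(1) by (simp add: word_morphism_def)
  have pow: "\<phi> (replicate n a) = word_pow (\<phi> [a]) n" for n a
    by (rule word_morphism_replicate[OF assms(1)])
  have rich: "rich (\<phi> w)" if "rich w" for w
    using assms(6) that by (simp add: preserves_richness_def)
  have ne: "\<phi> [x] \<noteq> []" for x
    using assms(2) by (simp add: non_erasing_def)
  define g where "g x = periodic_ext (\<phi> [x])" for x
  have "\<exists>s t. max_agreement (g a) (g b) s t" if "a \<noteq> b" for a b
    unfolding g_def using assms(3)[OF that] assms(4) ne by (intro max_agreement_exists)
  then obtain s t where agr: "max_agreement (g a) (g b) (s a b) (t a b)" if "a \<noteq> b" for a b
    by metis
  show ?thesis
  proof (cases "\<exists>a b :: 'a. a \<noteq> b")
    case False
    then obtain a :: 'a where a: "\<And>x. x = a"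
      by metis
    have "rich [a, a]"
      using rich_append_replicate_fresh[OF rich_Nil, of a 2]
      by (simp add: numeral_2_eq_2)
    then have "rich (\<phi> [a] @ \<phi> [a])"
      using rich append[of "[a]" "[a]"] by fastforce
    then obtain d where "d \<ge> 0" "mirror_symmetric (periodic_ext (\<phi> [a])) d"
      using mirror_symmetric_of_rich_square ne by blast
    \<comment> \<open>With a single letter there is nothing to agree on, so \<open>s = 0\<close> and
      \<open>t = d\<close> serve.\<close>
    then show ?thesis
      using a by (intro class_P_of_common_symmetry[OF assms(1,2), of 0 d]) (simp_all, metis+)
  next
    case True
    have sym: "mirror_symmetric (g a) (t a b - s a b)" if "a \<noteq> b" for a b
      unfolding g_def
    proof (rule mirror_symmetric_of_rich)
      show "max_agreement (periodic_ext (\<phi> [a])) (periodic_ext (\<phi> [b])) (s a b) (t a b)"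
        using agr[OF that] by (simp add: g_def)
      fix n m i :: nat assume "0 < m" "i \<le> n"
      then show "rich (word_pow (\<phi> [a]) n @ word_pow (\<phi> [b]) m @ word_pow (\<phi> [a]) i)"
        using rich[OF rich_two_letters[OF that]] by (simp add: append pow)
    qed (rule ne)+
    have triple: "t' - s' = t'' - s''"
      if "a \<noteq> b" "b \<noteq> c" "a \<noteq> c" "max_agreement (g a) (g b) s' t'" "max_agreement (g b) (g c) s'' t''"
      for a b c s' t' s'' t''
    proof (rule agreement_centers_eq_of_rich)
      show "max_agreement (periodic_ext (\<phi> [a])) (periodic_ext (\<phi> [b])) s' t'"
        "max_agreement (periodic_ext (\<phi> [b])) (periodic_ext (\<phi> [c])) s'' t''"
        using that by (simp_all add: g_def)
      fix n m k i :: nat assume "0 < m" "0 < k" "i \<le> n"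
      then show "rich (word_pow (\<phi> [a]) n @ (word_pow (\<phi> [b]) m @ word_pow (\<phi> [c]) k
        @ word_pow (\<phi> [b]) m) @ word_pow (\<phi> [a]) i)"
        using rich[OF rich_three_letters[OF that(1-3)]] by (simp add: append pow)
    qed (rule ne)+
    define \<delta> where "\<delta> a b = t a b - s a b" for a b
    \<comment> \<open>\<open>triple\<close> links the pairs \<open>(a, b)\<close> and
      \<open>(b, c)\<close>, and \<open>max_agreement_sym\<close> lets the values of
      \<open>(c, b)\<close> stand for the latter; so \<open>\<delta>\<close> depends only on its
      second argument.\<close>
    have \<delta>_swap: "\<delta> a b = \<delta> c b" if "a \<noteq> b" "c \<noteq> b" for a b c
    proof (cases "a = c")
      case False
      then show ?thesis
        unfolding \<delta>_def using triple[of a b c] agr[of a b] max_agreement_sym[OF agr[of c b]] that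
        by auto
    qed simp
    have \<delta>_sym: "\<delta> a b = \<delta> b a" if "a \<noteq> b" for a b
      using max_agreement_unique[OF agr[OF that] max_agreement_sym[OF agr]] that
      by (auto simp: \<delta>_def)
    obtain a\<^sub>0 b\<^sub>0 where min: "a\<^sub>0 \<noteq> b\<^sub>0" "\<And>a b. a \<noteq> b \<Longrightarrow> s a\<^sub>0 b\<^sub>0 \<le> s a b"
    proof -
      let ?S = "{ab :: 'a \<times> 'a. fst ab \<noteq> snd ab}"
      obtain a\<^sub>0 b\<^sub>0 where ab: "arg_min_on (case_prod s) ?S = (a\<^sub>0, b\<^sub>0)"
        by fastforce
      have S: "finite ?S" "?S \<noteq> {}"
        using True by auto
      show thesis
        using arg_min_if_finite[OF S, of "case_prod s"] that[of a\<^sub>0 b\<^sub>0] unfolding ab by force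
    qed
    \<comment> \<open>Any pair is joined to the minimising pair by steps that swap the two letters
      or replace the first one.\<close>
    have \<delta>_const: "\<delta> x y = \<delta> a\<^sub>0 b\<^sub>0" if "x \<noteq> y" for x y
    proof (cases "x = b\<^sub>0")
      case True
      then show ?thesis
        using \<delta>_sym[of x y] \<delta>_swap[of y b\<^sub>0 a\<^sub>0] min(1) that by simp
    next
      case False
      then show ?thesis
        using \<delta>_sym[of x y] \<delta>_swap[of y x b\<^sub>0] \<delta>_sym[of b\<^sub>0 x] \<delta>_swap[of x b\<^sub>0 a\<^sub>0] min(1) that
        by simp
    qed
    have st: "0 \<le> s a b" "0 \<le> t a b" if "a \<noteq> b" for a b
      using agr[OF that] by (auto simp: max_agreement_def)
    show ?thesis
    proof (rule class_P_of_common_symmetry[OF assms(1,2) st(1,2)[OF min(1)]])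
      fix x y j assume j: "- s a\<^sub>0 b\<^sub>0 \<le> j" "j < t a\<^sub>0 b\<^sub>0"
      show "periodic_ext (\<phi> [x]) j = periodic_ext (\<phi> [y]) j"
      proof (cases "x = y")
        case False
        \<comment> \<open>As \<open>\<delta>\<close> is constant, the pair that minimises
          \<open>s\<close> also minimises \<open>t\<close>, so its agreement interval is contained
          in that of every pair.\<close>
        then have "s a\<^sub>0 b\<^sub>0 \<le> s x y" "t a\<^sub>0 b\<^sub>0 \<le> t x y"
          using min(2)[OF False] \<delta>_const[OF False] by (simp_all add: \<delta>_def)
        then show ?thesis
          using agr[OF False] j by (auto simp: max_agreement_def g_def)
      qed simp
    next
      fix x :: 'a
      obtain y where "x \<noteq> y"
        using True by metis
      then show "mirror_symmetric (periodic_ext (\<phi> [x])) (t a\<^sub>0 b\<^sub>0 - s a\<^sub>0 b\<^sub>0)"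
        using sym[of x y] \<delta>_const[of x y] by (simp add: \<delta>_def g_def)
    qed
  qed
qed

end
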